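(* Let $p\equiv 1\pmod 6$ be a prime and $a\in\mathbb{F}_p^*$. Let $N$ be the number of $\mathbb{F}_p$-rational points (including the point at infinity) of the elliptic curve $y^{2}=x^{3}+a^{3}$ over $\mathbb{F}_p$. Then $a\in Q_p'$ if and only if $N\equiv 4\pmod 6$.
   Context: $Q_p'$ denotes the set of quadratic non-residues modulo $p$, i.e. the elements of $\mathbb{F}_p^*$ that are not squares. *)

theory Defs
  imports "HOL-Number_Theory.Residues"
begin

definition quad_nonresidues :: "nat \<Rightarrow> int set"
  where "quad_nonresidues p =
    (let F = residue_ring (int p)
     in {a \<in> Units F. \<not> (\<exists>b\<in>carrier F. b [^]\<^bsub>F\<^esub> (2::nat) = a)})"

datatype 'a curve_point = Infinity | Affine 'a 'a

text \<open>
  Rational points over \<open>R\<close> of the projective closure of \<open>y\<^sup>2 = x\<^sup>3 + A x + B\<close>,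
  which has exactly one point on the line at infinity when \<open>R\<close> is a field.
\<close>

definition weierstrass_points ::
  "('a, 'm) ring_scheme \<Rightarrow> 'a \<Rightarrow> 'a \<Rightarrow> 'a curve_point set"
  where "weierstrass_points R A B =
    insert Infinity
      {Affine x y | x y. x \<in> carrier R \<and> y \<in> carrier R \<and>
        y [^]\<^bsub>R\<^esub> (2::nat) = x [^]\<^bsub>R\<^esub> (3::nat) \<oplus>\<^bsub>R\<^esub> A \<otimes>\<^bsub>R\<^esub> x \<oplus>\<^bsub>R\<^esub> B}"

end

theory Submission
  imports Defs
begin

text \<open>
  Away from \<open>x = 0\<close> and \<open>y = 0\<close> the affine points fall into sets of size \<open>3 * 2\<close>, the fibres of
  \<open>(x, y) \<mapsto> (x\<^sup>3, y\<^sup>2)\<close>, because \<open>6\<close> divides \<open>p - 1\<close>. What is left modulo \<open>6\<close> is the point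
  at infinity, the three points with \<open>y = 0\<close> (cube roots of \<open>(-a)\<^sup>3\<close>), and the points with
  \<open>x = 0\<close>: two if \<open>a\<^sup>3\<close>, equivalently \<open>a\<close>, is a square, and none otherwise.
\<close>

lemma card_eq_mult_card_image:
  assumes "finite A" and "\<And>x. x \<in> A \<Longrightarrow> card {z \<in> A. f z = f x} = k"
  shows "card A = k * card (f ` A)"
proof -
  have "card A = (\<Sum>y\<in>f ` A. card {z \<in> A. f z = y})"
    using sum.image_gen[OF assms(1), of "\<lambda>_. 1::nat" f] by simp
  also have "\<dots> = (\<Sum>y\<in>f ` A. k)"
    by (rule sum.cong) (auto simp: assms(2))
  finally show ?thesis by simp
qed

context field
begin

text \<open>The multiplicative group is cyclic and \<open>n\<close> divides its order, so it
  contains exactly \<open>n\<close> roots of unity of exponent \<open>n\<close>. Multiplication by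
  \<open>c\<close>, with inverse multiplication by \<open>inv c\<close>, carries them onto the
  solutions of \<open>x [^] n = c [^] n\<close>.\<close>

lemma card_pow_eq_pow:
  assumes fin: "finite (carrier R)" and n: "n dvd card (carrier R) - 1"
    and c: "c \<in> carrier R" "c \<noteq> \<zero>"
  shows "card {x \<in> carrier R. x [^] n = c [^] n} = n"
proof -
  let ?U = "{x \<in> carrier R. x [^] n = \<one>}"
  interpret M: group "mult_of R" by (rule field_mult_group)
  have finM: "finite (carrier (mult_of R))" using fin by simp
  have ord: "order (mult_of R) = card (carrier R) - 1" 
    using fin by (simp add: order_def)
  have ord0: "card (carrier R) - 1 > 0"
    using ord M.order_gt_0_iff_finite finM by simp
  have n0: "n > 0" using n ord0 by (metis dvd_0_left_iff gr0I)
  have cU: "c \<in> Units R" using c by (simp add: field_Units)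
  have c_inv: "c [^] n \<otimes> inv c [^] n = \<one>"
    using c cU by (simp flip: nat_pow_distrib)
  have "card ?U = n"
  proof (rule antisym)
    show "card ?U \<le> n" using num_roots_le_deg[OF fin, of n] n0 by simp
    \<comment> \<open>For the lower bound, a generator \<open>g\<close> has order
      \<open>n * k\<close>, so \<open>g [^] k\<close> has order \<open>n\<close> and its first
      \<open>n\<close> powers are distinct roots of unity.\<close>
    obtain g where g: "g \<in> carrier (mult_of R)"
      and gen: "carrier (mult_of R) = {g [^] i | i::nat. i \<in> UNIV}"
      using finite_field_mult_group_has_gen[OF fin] by auto
    obtain k where k: "card (carrier R) - 1 = n * k" using n by blast
    have "generate (mult_of R) {g} = carrier (mult_of R)"
      unfolding M.generate_pow_on_finite_carrier[OF finM g] gen by (simp add: nat_pow_mult_of)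
    then have "M.ord g = n * k"
      using M.generate_pow_card[OF g] ord k by (simp add: order_def)
    moreover have "k \<noteq> 0" using ord0 k by (intro notI) simp
    ultimately have h: "M.ord (g [^] k) = n"
      using M.ord_pow[OF g, of k] by (simp add: nat_pow_mult_of)
    have hc: "g [^] k \<in> carrier (mult_of R)"
      using M.nat_pow_closed[OF g, of k] by (simp only: nat_pow_mult_of)
    \<comment> \<open>By \<open>n0\<close> the subtraction does not truncate, so this interval has
      exactly \<open>n\<close> elements.\<close>
    have "inj_on (\<lambda>i::nat. (g [^] k) [^] i) {0..n - 1}"
      using M.ord_inj[OF hc] h by (simp add: nat_pow_mult_of)
    moreover have "(\<lambda>i::nat. (g [^] k) [^] i) ` {0..n - 1} \<subseteq> ?U"
    proof clarify
      fix i :: nat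
      have "(g [^] k) [^] n = \<one>"
        using M.pow_ord_eq_1[OF hc] h by (simp add: nat_pow_mult_of)
      moreover have "((g [^] k) [^] i) [^] n = ((g [^] k) [^] n) [^] i"
        using g by (simp add: nat_pow_pow mult.commute mult.left_commute)
      ultimately show "(g [^] k) [^] i \<in> carrier R \<and> ((g [^] k) [^] i) [^] n = \<one>"
        using g by simp
    qed
    ultimately have "card {0..n - 1} \<le> card ?U"
      using fin by (intro card_inj_on_le[where f = "\<lambda>i::nat. (g [^] k) [^] i"]) auto
    then show "n \<le> card ?U" using n0 by simp
  qed
  moreover have "bij_betw (\<lambda>x. x \<otimes> c) ?U {x \<in> carrier R. x [^] n = c [^] n}"
    by (rule bij_betwI[where g = "\<lambda>x. x \<otimes> inv c"])
       (use c cU c_inv in \<open>auto simp: m_assoc nat_pow_distrib\<close>)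
  ultimately show ?thesis by (simp add: bij_betw_same_card)
qed

lemma pow_eq_zero_iff:
  assumes "x \<in> carrier R" and "n > 0"
  shows "x [^] (n::nat) = \<zero> \<longleftrightarrow> x = \<zero>"
  using assms(2,1)
  by (induction n rule: nat_induct_non_zero) (auto simp: integral_iff)

text \<open>The values are 1 + 3 + 2 and 1 + 3 + 0: infinity, the points with
  \<open>y = \<zero>\<close>, and those with \<open>x = \<zero>\<close>. Leaving 6 unreduced makes
  them the exact number of points outside \<open>S\<close>.\<close>

lemma card_weierstrass_points_cong:
  assumes fin: "finite (carrier R)" and q: "6 dvd card (carrier R) - 1"
    and a: "a \<in> carrier R" "a \<noteq> \<zero>"
  shows "[card (weierstrass_points R \<zero> (a [^] (3::nat)))
    = (if \<exists>b\<in>carrier R. b [^] (2::nat) = a then 6 else 4)] (mod 6)"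
proof -
  let ?b = "a [^] (3::nat)"
  let ?C = "{(x, y). x \<in> carrier R \<and> y \<in> carrier R \<and> y [^] (2::nat) = x [^] (3::nat) \<oplus> ?b}"
  let ?X = "{x \<in> carrier R. x [^] (3::nat) = (\<ominus> a) [^] (3::nat)}"
  let ?Y = "{y \<in> carrier R. y [^] (2::nat) = ?b}"
  define S where "S = {(x, y) \<in> ?C. x \<noteq> \<zero> \<and> y \<noteq> \<zero>}"
  have q23: "2 dvd card (carrier R) - 1" "3 dvd card (carrier R) - 1"
    by (rule dvd_trans[OF _ q], simp)+
  have bc: "?b \<in> carrier R" "?b \<noteq> \<zero>" using a pow_eq_zero_iff[of a 3] by auto
  \<comment> \<open>The points with \<open>y = \<zero>\<close> satisfy
    \<open>x [^] 3 = \<ominus> ?b\<close>; as the right side is a cube,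
    \<open>card_pow_eq_pow\<close> can count them.\<close>
  have neg: "(\<ominus> a) [^] (3::nat) = \<ominus> ?b"
    using a by (simp add: numeral_eq_Suc l_minus r_minus)
  have finC: "finite ?C" by (rule finite_subset[of _ "carrier R \<times> carrier R"]) (use fin in auto)
  have sixS: "6 dvd card S"
  proof -
    have "card S = 6 * card ((\<lambda>(x, y). (x [^] (3::nat), y [^] (2::nat))) ` S)"
    proof (rule card_eq_mult_card_image)
      show "finite S" unfolding S_def by (rule finite_subset[OF _ finC]) auto
      fix z assume "z \<in> S"
      then obtain u v where z: "z = (u, v)" and uv: "(u, v) \<in> S" by (cases z) auto
      from uv have u: "u \<in> carrier R" "u \<noteq> \<zero>" and v: "v \<in> carrier R" "v \<noteq> \<zero>"
        and e: "v [^] (2::nat) = u [^] (3::nat) \<oplus> ?b" unfolding S_def by auto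
      \<comment> \<open>Membership in \<open>S\<close> depends only on the cube of \<open>x\<close>
        and the square of \<open>y\<close>, vanishing included, so the fibre is a full
        product.\<close>
      have "{w \<in> S. (\<lambda>(x, y). (x [^] (3::nat), y [^] (2::nat))) w
                   = (\<lambda>(x, y). (x [^] (3::nat), y [^] (2::nat))) z}
          = {x \<in> carrier R. x [^] (3::nat) = u [^] (3::nat)} \<times>
            {y \<in> carrier R. y [^] (2::nat) = v [^] (2::nat)}"
        unfolding S_def z using u v e pow_eq_zero_iff[of u 3] pow_eq_zero_iff[of v 2]
          pow_eq_zero_iff[of \<zero> 3] pow_eq_zero_iff[of \<zero> 2]
        by auto
      then show "card {w \<in> S. (\<lambda>(x, y). (x [^] (3::nat), y [^] (2::nat))) w
                   = (\<lambda>(x, y). (x [^] (3::nat), y [^] (2::nat))) z} = 6"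
        using card_pow_eq_pow[OF fin q23(2) u] card_pow_eq_pow[OF fin q23(1) v]
        by (simp add: card_cartesian_product)
    qed
    then show ?thesis by simp
  qed
  have cardX: "card ?X = 3"
    using card_pow_eq_pow[OF fin q23(2), of "\<ominus> a"] a by (metis a_inv_closed minus_minus minus_zero)
  have cardY: "card ?Y = (if \<exists>b\<in>carrier R. b [^] (2::nat) = a then 2 else 0)"
  proof (cases "\<exists>b\<in>carrier R. b [^] (2::nat) = a")
    case True
    then obtain b where b: "b \<in> carrier R" "b [^] (2::nat) = a" by blast
    have "b \<noteq> \<zero>" using a b by (auto simp: pow_eq_zero_iff)
    then have "b [^] (3::nat) \<noteq> \<zero>" using b pow_eq_zero_iff[of b 3] by simp
    \<comment> \<open>A square root \<open>b\<close> of \<open>a\<close> gives the square root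
      \<open>b [^] 3\<close> of \<open>?b\<close>, so \<open>?Y\<close> is the set of elements with
      the same square as \<open>b [^] 3\<close>.\<close>
    moreover have "(b [^] (3::nat)) [^] (2::nat) = ?b"
      using b by (metis nat_pow_pow mult.commute)
    ultimately show ?thesis
      using card_pow_eq_pow[OF fin q23(1), of "b [^] (3::nat)"] b True by simp
  next
    case False
    have aU: "a \<in> Units R" using a by (simp add: field_Units)
    \<comment> \<open>Conversely, dividing a square root of the cube of \<open>a\<close> by
      \<open>a\<close> would give a square root of \<open>a\<close>.\<close>
    have "(y \<otimes> inv a) [^] (2::nat) = a" if y: "y \<in> carrier R" "y [^] (2::nat) = ?b" for y
    proof -
      have aU: "a \<in> Units R" using a by (simp add: field_Units)
    have "(y \<otimes> inv a) [^] (2::nat) = ?b \<otimes> (inv a \<otimes> inv a)"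
        using y aU by (simp add: nat_pow_distrib) (simp add: numeral_eq_Suc)
      also have "\<dots> = a \<otimes> (a \<otimes> inv a) \<otimes> (a \<otimes> inv a)"
        using a aU by (simp add: numeral_eq_Suc m_ac del: Units_r_inv Units_l_inv)
      finally show ?thesis using a aU by simp
    qed
    moreover have "y \<otimes> inv a \<in> carrier R" if "y \<in> carrier R" for y
      using that aU by simp
    ultimately have "?Y = {}" using False by blast
    then show ?thesis using False by (simp only: card.empty if_False)
  qed
  have C: "?C = S \<union> ((\<lambda>x. (x, \<zero>)) ` ?X \<union> Pair \<zero> ` ?Y)"
  proof -
    have "x [^] (3::nat) \<oplus> ?b = \<zero> \<longleftrightarrow> x [^] (3::nat) = \<ominus> ?b" if "x \<in> carrier R" for x
      using that bc by (metis l_neg minus_equality nat_pow_closed)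
    moreover have "\<zero> [^] (2::nat) = \<zero>" "\<zero> [^] (3::nat) = \<zero>"
      by (simp_all add: pow_eq_zero_iff)
    ultimately show ?thesis unfolding S_def neg using bc by (auto simp: image_iff l_neg)
  qed
  have "card ?C = card S + (card ?X + card ?Y)"
  proof -
    have "card ((\<lambda>x. (x, \<zero>)) ` ?X \<union> Pair \<zero> ` ?Y) = card ?X + card ?Y"
    proof (subst card_Un_disjoint)
      \<comment> \<open>A common point would be the origin, which is off the curve because
        \<open>?b\<close> is nonzero.\<close>
      show "(\<lambda>x. (x, \<zero>)) ` ?X \<inter> Pair \<zero> ` ?Y = {}"
        using bc pow_eq_zero_iff[of \<zero> 2] by auto
    qed (use fin in \<open>auto simp: card_image inj_on_def\<close>)
    moreover have "S \<inter> ((\<lambda>x. (x, \<zero>)) ` ?X \<union> Pair \<zero> ` ?Y) = {}" unfolding S_def by auto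
    moreover have "finite S" "finite ((\<lambda>x. (x, \<zero>)) ` ?X \<union> Pair \<zero> ` ?Y)"
      using finC unfolding C by simp_all
    ultimately show ?thesis unfolding C by (simp only: card_Un_disjoint)
  qed
  moreover have "card (weierstrass_points R \<zero> ?b) = Suc (card ?C)"
  proof -
    have "weierstrass_points R \<zero> ?b = insert Infinity (case_prod Affine ` ?C)"
      unfolding weierstrass_points_def using bc by (auto simp: image_iff)
    moreover have "inj_on (case_prod Affine) ?C" by (auto simp: inj_on_def)
    then have "card (case_prod Affine ` ?C) = card ?C" by (rule card_image)
    moreover have "Infinity \<notin> case_prod Affine ` ?C" by auto
    ultimately show ?thesis using finC by simp
  qed
  ultimately have "card (weierstrass_points R \<zero> ?b) =
      card S + (if \<exists>b\<in>carrier R. b [^] (2::nat) = a then 6 else 4)"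
    using cardX cardY by simp
  then show ?thesis using sixS by (auto simp: cong_def elim!: dvdE)
qed

end

theorem theorem15:
  fixes p :: nat and a :: int and F :: "int ring" and N :: nat
  defines "F \<equiv> residue_ring (int p)"
  defines "N \<equiv> card (weierstrass_points F \<zero>\<^bsub>F\<^esub> (a [^]\<^bsub>F\<^esub> (3::nat)))"
  assumes "prime p" and "[p = 1] (mod 6)" and "a \<in> Units F"
  shows "a \<in> quad_nonresidues p \<longleftrightarrow> [N = 4] (mod 6)"
proof -
  interpret residues_prime p F
    using assms(3) by unfold_locales (simp_all add: F_def)
  have "6 dvd card (carrier F) - 1"
    using \<open>[p = 1] (mod 6)\<close> cong_altdef_nat[of 1 p 6] prime_ge_1_nat[OF p_prime]
    by (simp add: res_carrier_eq)
  moreover have "a \<in> carrier F" "a \<noteq> \<zero>\<^bsub>F\<^esub>"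
    using \<open>a \<in> Units F\<close> by (auto simp: field_Units)
  ultimately have "[N = (if \<exists>b\<in>carrier F. b [^]\<^bsub>F\<^esub> (2::nat) = a then 6 else 4)] (mod 6)"
    unfolding N_def by (intro card_weierstrass_points_cong) simp_all
  \<comment> \<open>Since 6 and 4 are incongruent modulo 6, the residue of \<open>N\<close> decides
    whether the unit \<open>a\<close> is a square.\<close>
  then show ?thesis
    using \<open>a \<in> Units F\<close>
    by (auto simp: quad_nonresidues_def Let_def cong_def simp flip: F_def split: if_splits)
qed

end
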